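(* Let $n=bq$ and let $\mathcal{W}\subseteq\mathbb{R}^n$ be the span of the vectors $\mathbf{e}_{ib+1}$ ($i=0,\dots,q-1$) and the indicator vectors $\mathbf{e}_{\mathcal{B}_i}$ of the vertex blocks $\mathcal{B}_i$ ($i=0,\dots,q-1$) of the ring of cliques $\mathcal{R}_{b,q}$. Let $\mathbf{P}_{\mathcal{W}}$ be the orthogonal projector onto $\mathcal{W}$. For any nonzero vector $\mathbf{y}\in\mathbb{R}^n$ orthogonal to $\mathbf{1}$, define $\mathbf{z}=(\mathbf{I}-\mathbf{P}_{\mathcal{W}})\mathbf{y}$. If $$\|\mathbf{z}\|_2\le(1+2qn)^{-1/2}\|\mathbf{y}\|_2 ,$$ then $\mathbf{y}$ recovers all the cliques of $\mathcal{R}_{b,q}$.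
   Context: For integers $b\ge 2$, $q\ge 3$, the ring of cliques $\mathcal{R}_{b,q}$ is the graph on vertices $1,\dots,n$ ($n=bq$) consisting of $q$ cliques $\{ib+1,\dots,ib+b\}$, $i=0,\dots,q-1$, with the corner vertices $ib+1$ joined cyclically to form a ring. The vertex blocks are the sets of internal (non-corner) vertices $\mathcal{B}_i=\{ib+2,\dots,ib+b\}$, and $\mathbf{e}_{\mathcal{B}_i}$ is the $0/1$ indicator vector of $\mathcal{B}_i$; $\mathbf{e}_{m}$ is the $m$-th standard basis vector of $\mathbb{R}^n$; $\mathbf{1}$ is the all-ones vector. A vector $\mathbf{y}\in\mathbb{R}^n$ recovers all the cliques of $\mathcal{R}_{b,q}$ if there is a threshold $t\in(\min_i y_i,\max_i y_i)$ such that for every block $\mathcal{B}_i$ and all $j,k\in\mathcal{B}_i$: $y_j<t$ if and only if $y_k<t$. *)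

theory Defs
  imports "HOL-Analysis.Analysis" "Graph_Theory.Pair_Digraph"
begin

definition clique :: "nat \<Rightarrow> nat \<Rightarrow> nat set"
  where "clique b i = {i * b + 1..i * b + b}"

definition corner :: "nat \<Rightarrow> nat \<Rightarrow> nat"
  where "corner b i = i * b + 1"

definition vertex_block :: "nat \<Rightarrow> nat \<Rightarrow> nat set"
  where "vertex_block b i = {i * b + 2..i * b + b}"

lemma vertex_block_eq: "vertex_block b i = clique b i - {corner b i}"
  by (auto simp: vertex_block_def clique_def corner_def)

definition ring_of_cliques :: "nat \<Rightarrow> nat \<Rightarrow> nat pair_pre_digraph"
  where "ring_of_cliques b q =
    \<lparr> pverts = {1..b * q},
      parcs = {(u, w). u \<noteq> w \<and> (\<exists>i<q. u \<in> clique b i \<and> w \<in> clique b i)} \<union>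
        {(u, w). \<exists>i<q. {u, w} = {corner b i, corner b ((i + 1) mod q)}} \<rparr>"

lemma clique_subset:
  assumes "i < q"
  shows "clique b i \<subseteq> {1..b * q}"
proof -
  have "i * b + b \<le> b * q"
    using mult_le_mono1[of "Suc i" q b] assms by (simp add: algebra_simps)
  then show ?thesis
    by (auto simp: clique_def)
qed

lemma pair_graph_ring_of_cliques:
  assumes "b \<ge> 2" "q \<ge> 3"
  shows "pair_graph (ring_of_cliques b q)"
proof -
  let ?R = "ring_of_cliques b q"
  have corner: "corner b i \<in> {1..b * q}" if "i < q" for i
    using clique_subset[OF that, of b] assms by (force simp: clique_def corner_def)
  have ends: "u \<in> {1..b * q} \<and> w \<in> {1..b * q}" if "(u, w) \<in> parcs ?R" for u w
  proof -
    consider i where "i < q" "u \<in> clique b i" "w \<in> clique b i"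
      | i where "i < q" "{u, w} = {corner b i, corner b ((i + 1) mod q)}"
      using \<open>(u, w) \<in> parcs ?R\<close> by (auto simp: ring_of_cliques_def)
    then show ?thesis
    proof cases
      case 1
      then show ?thesis using clique_subset by blast
    next
      case 2
      have "(i + 1) mod q < q" using assms by simp
      then show ?thesis
        using 2 corner[of i] corner[of "(i + 1) mod q"] by (metis doubleton_eq_iff)
    qed
  qed
  have loopfree: "u \<noteq> w" if "(u, w) \<in> parcs ?R" for u w
  proof
    assume "u = w"
    with that obtain i where i: "i < q" "{u} = {corner b i, corner b ((i + 1) mod q)}"
      by (auto simp: ring_of_cliques_def)
    then have "corner b i = corner b ((i + 1) mod q)"
      by (metis insertI1 insert_commute singletonD)
    then have "i = (i + 1) mod q"
      using assms by (simp add: corner_def)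
    then show False
      using assms i(1) by (cases "i + 1 = q") auto
  qed
  have "parcs ?R \<subseteq> {1..b * q} \<times> {1..b * q}"
    using ends by auto
  then have fin: "finite (parcs ?R)"
    by (rule finite_subset) simp
  have sym: "(w, u) \<in> parcs ?R" if "(u, w) \<in> parcs ?R" for u w
    using that by (auto simp: ring_of_cliques_def insert_commute)
  have V: "pverts ?R = {1..b * q}"
    by (simp add: ring_of_cliques_def)
  show ?thesis
  proof unfold_locales
    show "symmetric (with_proj ?R)"
      using sym by (auto simp: symmetric_def intro: symI)
  qed (use ends loopfree fin V in \<open>auto simp: prod_eq_iff\<close>)
qed

text \<open>
  The coordinates of \<open>real ^ 'n\<close> are labelled by the vertices through a bijection \<open>v\<close> from
  \<open>pverts (ring_of_cliques b q) = {1..b * q}\<close> onto \<open>'n\<close>, so that \<open>y $ v m\<close> is the \<open>m\<close>-th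
  entry of \<open>y\<close>.
\<close>

definition std_vec :: "(nat \<Rightarrow> 'n) \<Rightarrow> nat \<Rightarrow> real ^ 'n::finite"
  where "std_vec v m = axis (v m) 1"

definition indicator_vec :: "(nat \<Rightarrow> 'n) \<Rightarrow> nat set \<Rightarrow> real ^ 'n::finite"
  where "indicator_vec v S = (\<chi> k. if k \<in> v ` S then 1 else 0)"

definition clique_space :: "nat \<Rightarrow> nat \<Rightarrow> (nat \<Rightarrow> 'n) \<Rightarrow> (real ^ 'n::finite) set"
  where "clique_space b q v =
    span ({std_vec v (i * b + 1) | i. i < q} \<union> {indicator_vec v (vertex_block b i) | i. i < q})"

definition orth_proj :: "'a::euclidean_space set \<Rightarrow> 'a \<Rightarrow> 'a"
  where "orth_proj W y = (THE p. p \<in> W \<and> (\<forall>w\<in>W. orthogonal (y - p) w))"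

lemma orth_proj:
  assumes "subspace W"
  shows orth_proj_in: "orth_proj W y \<in> W"
    and orth_proj_orthogonal: "\<And>w. w \<in> W \<Longrightarrow> orthogonal (y - orth_proj W y) w"
proof -
  let ?P = "\<lambda>p. p \<in> W \<and> (\<forall>w\<in>W. orthogonal (y - p) w)"
  have "span W = W"
    using assms by (simp add: span_eq_iff)
  then obtain p r where pr: "p \<in> W" "\<And>w. w \<in> W \<Longrightarrow> orthogonal r w" "y = p + r"
    using orthogonal_subspace_decomp_exists[of W y] by metis
  have "\<exists>!p. ?P p"
  proof (rule ex1I[of _ p])
    show "?P p" using pr by simp
  next
    fix p' assume p': "?P p'"
    have d: "p - p' \<in> W"
      using assms pr(1) p' by (simp add: subspace_diff)
    have "(y - p') \<bullet> (p - p') = 0" "(y - p) \<bullet> (p - p') = 0"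
      using d p' pr by (auto simp: orthogonal_def)
    then have "(p - p') \<bullet> (p - p') = 0"
      by (simp add: inner_diff_left)
    then show "p' = p" by simp
  qed
  then have "?P (orth_proj W y)"
    unfolding orth_proj_def by (rule theI')
  then show "orth_proj W y \<in> W" "\<And>w. w \<in> W \<Longrightarrow> orthogonal (y - orth_proj W y) w"
    by auto
qed

definition recovers_cliques :: "nat \<Rightarrow> nat \<Rightarrow> (nat \<Rightarrow> 'n) \<Rightarrow> real ^ 'n::finite \<Rightarrow> bool"
  where "recovers_cliques b q v y \<longleftrightarrow>
    (\<exists>t. Min (range (\<lambda>k. y $ k)) < t \<and> t < Max (range (\<lambda>k. y $ k)) \<and>
      (\<forall>i<q. \<forall>j\<in>vertex_block b i. \<forall>k\<in>vertex_block b i. y $ v j < t \<longleftrightarrow> y $ v k < t))"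

end

theory Submission
  imports Defs
begin

text \<open>
  Vectors of \<open>\<W>\<close> are constant on every block, so on a block \<open>y\<close> varies exactly as much as \<open>z\<close>:
  the spread \<open>r\<^sub>i\<close> of \<open>y\<close> on the \<open>i\<close>-th block satisfies \<open>r\<^sub>i\<^sup>2 \<le> 2 \<parallel>z\<^sub>i\<parallel>\<^sup>2\<close>, where \<open>z\<^sub>i\<close> is
  the restriction of \<open>z\<close>. By Cauchy-Schwarz the \<open>q\<close> spreads add up to at most \<open>sqrt (2q) \<parallel>z\<parallel>\<close>,
  which is less than \<open>\<parallel>y\<parallel> / sqrt n\<close>. As \<open>y\<close> is orthogonal to the all-ones vector, its total range
  \<open>max y - min y\<close> is at least \<open>\<parallel>y\<parallel> / sqrt n\<close>. Hence the intervals spanned by \<open>y\<close> on the blocks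
  cannot cover \<open>(min y, max y)\<close>, and any uncovered point is a valid threshold.
\<close>

text \<open>Lebesgue measure is subadditive, so finitely many intervals of total length below
  \<open>M - m\<close> cannot cover \<open>{m<..<M}\<close>. The intervals are half-open because
  \<open>t\<close> avoids \<open>{lo i<..hi i}\<close> exactly when \<open>t \<le> lo i\<close> or
  \<open>hi i < t\<close>, that is, when \<open>t\<close> is a threshold that does not split the
  values in \<open>{lo i..hi i}\<close>.\<close>

lemma exists_uncovered_point:
  fixes lo hi :: "'i \<Rightarrow> real" and m M :: real
  assumes "finite I" and le: "\<And>i. i \<in> I \<Longrightarrow> lo i \<le> hi i"
    and less: "(\<Sum>i\<in>I. hi i - lo i) < M - m"
  shows "\<exists>t. m < t \<and> t < M \<and> (\<forall>i\<in>I. t \<notin> {lo i<..hi i})"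
proof (rule ccontr)
  assume "\<not> ?thesis"
  then have cover: "{m<..<M} \<subseteq> (\<Union>i\<in>I. {lo i<..hi i})"
    by auto
  \<comment> \<open>This rules out \<open>M < m\<close>, where \<open>ennreal\<close> would truncate
    \<open>M - m\<close> to 0.\<close>
  have "0 \<le> (\<Sum>i\<in>I. hi i - lo i)"
    using le by (intro sum_nonneg) auto
  then have "m \<le> M"
    using less by linarith
  then have "ennreal (M - m) = emeasure lborel {m<..<M}"
    by simp
  also have "\<dots> \<le> emeasure lborel (\<Union>i\<in>I. {lo i<..hi i})"
    using cover \<open>finite I\<close> by (intro emeasure_mono) auto
  also have "\<dots> \<le> (\<Sum>i\<in>I. emeasure lborel {lo i<..hi i})"
    using \<open>finite I\<close> by (intro emeasure_subadditive_finite) auto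
  also have "\<dots> = (\<Sum>i\<in>I. ennreal (hi i - lo i))"
    using le by (intro sum.cong) auto
  also have "\<dots> = ennreal (\<Sum>i\<in>I. hi i - lo i)"
    using le by (intro sum_ennreal) auto
  finally show False
    using less le by (simp add: ennreal_le_iff sum_nonneg)
qed

text \<open>The entries sum to zero, so 0 lies between the minimum and the maximum, and every entry
  is at most their difference in absolute value.\<close>

lemma norm_le_range_if_orthogonal_ones:
  fixes y :: "real ^ 'n::finite"
  assumes "orthogonal y (\<chi> k. 1)"
  shows "norm y \<le> sqrt (real CARD('n)) * (Max (range (\<lambda>k. y $ k)) - Min (range (\<lambda>k. y $ k)))"
proof -
  define M where "M = Max (range (\<lambda>k. y $ k))"
  define m where "m = Min (range (\<lambda>k. y $ k))"
  have bounds: "m \<le> y $ k" "y $ k \<le> M" for k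
    by (auto simp: m_def M_def)
  have sum0: "(\<Sum>k\<in>UNIV. y $ k) = 0"
    using assms by (simp add: orthogonal_def inner_vec_def)
  have "(\<Sum>k\<in>UNIV. y $ k) \<le> (\<Sum>k\<in>(UNIV :: 'n set). M)"
    "(\<Sum>k\<in>(UNIV :: 'n set). m) \<le> (\<Sum>k\<in>UNIV. y $ k)"
    by (intro sum_mono bounds)+
  then have "m \<le> 0" "0 \<le> M"
    using sum0 by (simp_all add: zero_le_mult_iff mult_le_0_iff)
  have "(y $ k)\<^sup>2 \<le> (M - m)\<^sup>2" for k
    using bounds[of k] \<open>m \<le> 0\<close> \<open>0 \<le> M\<close> by (intro abs_le_square_iff[THEN iffD1]) auto
  then have "(\<Sum>k\<in>UNIV. (y $ k)\<^sup>2) \<le> real CARD('n) * (M - m)\<^sup>2"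
    using sum_bounded_above[of UNIV "\<lambda>k. (y $ k)\<^sup>2" "(M - m)\<^sup>2"] by simp
  then have "norm y \<le> sqrt (real CARD('n) * (M - m)\<^sup>2)"
    by (simp add: norm_vec_def L2_set_def)
  then show ?thesis
    using \<open>m \<le> 0\<close> \<open>0 \<le> M\<close> by (simp add: real_sqrt_mult M_def m_def)
qed

lemma square_diff_le_sum_squares:
  fixes f :: "'a \<Rightarrow> real"
  assumes "finite A" "j \<in> A" "k \<in> A"
  shows "(f j - f k)\<^sup>2 \<le> 2 * (\<Sum>a\<in>A. (f a)\<^sup>2)"
proof (cases "j = k")
  case True
  then show ?thesis by (simp add: sum_nonneg)
next
  case False
  have "0 \<le> (f j + f k)\<^sup>2"
    by simp
  then have "(f j - f k)\<^sup>2 \<le> 2 * ((f j)\<^sup>2 + (f k)\<^sup>2)"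
    by (simp add: power2_sum power2_diff)
  also have "(f j)\<^sup>2 + (f k)\<^sup>2 = (\<Sum>a\<in>{j, k}. (f a)\<^sup>2)"
    using False by simp
  also have "\<dots> \<le> (\<Sum>a\<in>A. (f a)\<^sup>2)"
    using assms by (intro sum_mono2) auto
  finally show ?thesis by simp
qed

lemma clique_disjoint:
  assumes "i \<noteq> i'"
  shows "clique b i \<inter> clique b i' = {}"
proof -
  have "clique b i \<inter> clique b i' = {}" if "i < i'" for i i'
  proof -
    have "i * b + b \<le> i' * b"
      using mult_le_mono1[of "Suc i" i' b] that by simp
    then show ?thesis
      by (auto simp: clique_def)
  qed
  then show ?thesis
    using assms by (metis inf_commute nat_neq_iff)
qed

lemma vertex_block_subset_clique: "vertex_block b i \<subseteq> clique b i"
  by (auto simp: vertex_block_eq)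

text \<open>The vectors that agree at \<open>v j\<close> and \<open>v k\<close> form a subspace, so
  it suffices to check the spanning vectors. For these, injectivity of \<open>v\<close> and
  disjointness of the cliques decide.\<close>

lemma clique_space_constant_on_block:
  fixes v :: "nat \<Rightarrow> 'n::finite"
  assumes inj: "inj_on v {1..b * q}" and "i < q" and p: "p \<in> clique_space b q v"
    and j: "j \<in> vertex_block b i" and k: "k \<in> vertex_block b i"
  shows "p $ v j = p $ v k"
proof -
  let ?S = "{p :: real ^ 'n. p $ v j = p $ v k}"
  have jk: "j \<in> clique b i" "k \<in> clique b i" "j \<noteq> corner b i" "k \<noteq> corner b i"
    using j k by (auto simp: vertex_block_eq)
  have mem: "j \<in> {1..b * q}" "k \<in> {1..b * q}"
    using clique_subset[OF \<open>i < q\<close>] jk by blast+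
  have "subspace ?S"
    by (auto simp: subspace_def)
  moreover have "std_vec v (i' * b + 1) \<in> ?S" if "i' < q" for i'
  proof -
    let ?c = "i' * b + 1"
    have ne: "j \<noteq> ?c \<and> k \<noteq> ?c"
    proof (cases "i' = i")
      case True
      then show ?thesis using jk by (simp add: corner_def)
    next
      case False
      \<comment> \<open>The corner lies in its clique only if \<open>b\<close> is positive, which
        follows from the block containing \<open>j\<close>.\<close>
      have "?c \<in> clique b i'"
        using j by (auto simp: clique_def vertex_block_def)
      then show ?thesis
        using clique_disjoint[OF False, of b] jk by auto
    qed
    have "?c \<in> clique b i'"
      using j by (auto simp: clique_def vertex_block_def)
    then have "?c \<in> {1..b * q}"
      using clique_subset[OF that] by blast
    then have "v j \<noteq> v ?c" "v k \<noteq> v ?c"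
      using ne mem inj_onD[OF inj] by blast+
    then show ?thesis
      by (simp add: std_vec_def axis_def)
  qed
  moreover have "indicator_vec v (vertex_block b i') \<in> ?S" if "i' < q" for i'
  proof -
    have "vertex_block b i' \<subseteq> {1..b * q}"
      using clique_subset[OF that] vertex_block_subset_clique by blast
    then have "v l \<in> v ` vertex_block b i' \<longleftrightarrow> l \<in> vertex_block b i'" if "l \<in> {1..b * q}" for l
      using inj_on_image_mem_iff[OF inj that] by simp
    moreover have "j \<in> vertex_block b i' \<longleftrightarrow> k \<in> vertex_block b i'"
      using j k clique_disjoint[of i i' b] vertex_block_subset_clique by blast
    ultimately show ?thesis
      using mem by (simp add: indicator_vec_def)
  qed
  ultimately have "clique_space b q v \<subseteq> ?S"
    unfolding clique_space_def by (intro span_minimal) auto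
  then show ?thesis
    using p by auto
qed

text \<open>The blocks are disjoint and \<open>v\<close> is injective, so the double sum meets each
  coordinate of \<open>z\<close> at most once.\<close>

lemma sum_block_squares_le:
  fixes v :: "nat \<Rightarrow> 'n::finite" and z :: "real ^ 'n"
  assumes "inj_on v {1..b * q}"
  shows "(\<Sum>i<q. \<Sum>j\<in>vertex_block b i. (z $ v j)\<^sup>2) \<le> (norm z)\<^sup>2"
proof -
  let ?U = "\<Union>i<q. vertex_block b i"
  have "?U \<subseteq> {1..b * q}"
    using clique_subset vertex_block_subset_clique by blast
  then have inj: "inj_on v ?U"
    using assms inj_on_subset by blast
  have "(\<Sum>i<q. \<Sum>j\<in>vertex_block b i. (z $ v j)\<^sup>2) = (\<Sum>j\<in>?U. (z $ v j)\<^sup>2)"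
  proof (rule sum.UNION_disjoint[symmetric])
    show "\<forall>i\<in>{..<q}. finite (vertex_block b i)"
      by (simp add: vertex_block_def)
    show "\<forall>i\<in>{..<q}. \<forall>i'\<in>{..<q}. i \<noteq> i' \<longrightarrow> vertex_block b i \<inter> vertex_block b i' = {}"
      using clique_disjoint vertex_block_subset_clique by blast
  qed simp
  also have "\<dots> = (\<Sum>k\<in>v ` ?U. (z $ k)\<^sup>2)"
    using inj by (simp add: sum.reindex)
  also have "\<dots> \<le> (\<Sum>k\<in>UNIV. (z $ k)\<^sup>2)"
    by (intro sum_mono2) auto
  also have "\<dots> = (norm z)\<^sup>2"
    by (simp add: norm_vec_def L2_set_def sum_nonneg)
  finally show ?thesis .
qed

theorem theorem10:
  fixes b q n :: nat
    and v :: "nat \<Rightarrow> 'n::finite"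
    and y z :: "real ^ 'n"
  assumes "b \<ge> 2" and "q \<ge> 3" and "n = b * q"
    and "bij_betw v (pverts (ring_of_cliques b q)) UNIV"
    and "y \<noteq> 0"
    and "orthogonal y (\<chi> k. 1)"
    and "z = y - orth_proj (clique_space b q v) y"
    and "norm z \<le> (1 + 2 * real q * real n) powr (- 1 / 2) * norm y"
  shows "recovers_cliques b q v y"
proof -
  define B where "B = vertex_block b"
  define M where "M = Max (range (\<lambda>k. y $ k))"
  define m where "m = Min (range (\<lambda>k. y $ k))"
  define hi where "hi i = Max ((\<lambda>j. y $ v j) ` B i)" for i
  define lo where "lo i = Min ((\<lambda>j. y $ v j) ` B i)" for i
  have bij: "bij_betw v {1..b * q} UNIV"
    using assms(4) by (simp add: ring_of_cliques_def)
  then have inj: "inj_on v {1..b * q}"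
    by (rule bij_betw_imp_inj_on)
  have card: "CARD('n) = n"
    using bij_betw_same_card[OF bij] assms(3) by simp
  have fin: "finite (B i)" and ne: "B i \<noteq> {}" for i
    using assms(1) by (simp_all add: B_def vertex_block_def)
  have lo_hi: "lo i \<le> y $ v j" "y $ v j \<le> hi i" if "j \<in> B i" for i j
    using that fin by (auto simp: lo_def hi_def)
  have lo_le_hi: "lo i \<le> hi i" for i
    using ne[of i] lo_hi[of _ i] by fastforce
  have proj_in: "orth_proj (clique_space b q v) y \<in> clique_space b q v"
    by (rule orth_proj_in) (simp add: clique_space_def)
  \<comment> \<open>\<open>y - z\<close> is the projection, which is constant on each block.\<close>
  have same_diff: "y $ v j - y $ v k = z $ v j - z $ v k"
    if "i < q" "j \<in> B i" "k \<in> B i" for i j k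
    using clique_space_constant_on_block[OF inj that(1) proj_in that(2,3)[unfolded B_def]]
    by (simp add: assms(7))
  have spread: "(hi i - lo i)\<^sup>2 \<le> 2 * (\<Sum>j\<in>B i. (z $ v j)\<^sup>2)" if "i < q" for i
  proof -
    have "hi i \<in> (\<lambda>j. y $ v j) ` B i" "lo i \<in> (\<lambda>j. y $ v j) ` B i"
      using fin ne by (simp_all add: hi_def lo_def Max_in Min_in)
    then obtain j k where "j \<in> B i" "hi i = y $ v j" "k \<in> B i" "lo i = y $ v k"
      by blast
    then show ?thesis
      using same_diff[OF that] square_diff_le_sum_squares[OF fin, of j i k "\<lambda>j. z $ v j"] by simp
  qed
  have "(\<Sum>i<q. hi i - lo i)\<^sup>2 \<le> real q * (\<Sum>i<q. (hi i - lo i)\<^sup>2)"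
    using Cauchy_Schwarz_ineq_sum[of "\<lambda>_. 1" "\<lambda>i. hi i - lo i" "{..<q}"] by simp
  also have "(\<Sum>i<q. (hi i - lo i)\<^sup>2) \<le> 2 * (norm z)\<^sup>2"
  proof -
    have "(\<Sum>i<q. (hi i - lo i)\<^sup>2) \<le> 2 * (\<Sum>i<q. \<Sum>j\<in>B i. (z $ v j)\<^sup>2)"
      unfolding sum_distrib_left using spread by (intro sum_mono) (simp add: sum_distrib_left)
    then show ?thesis
      using sum_block_squares_le[OF inj, of z] by (simp add: B_def)
  qed
  finally have sum_sq: "(\<Sum>i<q. hi i - lo i)\<^sup>2 \<le> 2 * real q * (norm z)\<^sup>2"
    by (simp add: mult_left_mono mult.assoc)
  define D where "D = 1 + 2 * real q * real n"
  have "n > 0" "D > 0"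
    using assms(1-3) by (simp_all add: D_def add_pos_nonneg)
  have "(norm z)\<^sup>2 \<le> (D powr (- 1 / 2) * norm y)\<^sup>2"
    using assms(8) by (intro power_mono) (auto simp: D_def)
  also have "\<dots> = (norm y)\<^sup>2 / D"
  proof -
    have "(D powr (- 1 / 2))\<^sup>2 = D powr (- 1)"
      using \<open>D > 0\<close> by (simp add: power2_eq_square flip: powr_add)
    also have "\<dots> = 1 / D"
      using \<open>D > 0\<close> by (simp add: powr_minus_divide)
    finally show ?thesis
      unfolding power_mult_distrib by simp
  qed
  finally have "D * (norm z)\<^sup>2 \<le> (norm y)\<^sup>2"
    using \<open>D > 0\<close> by (simp add: field_simps)
  then have z_le: "(norm z)\<^sup>2 + real n * (2 * real q * (norm z)\<^sup>2) \<le> (norm y)\<^sup>2"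
    by (simp add: D_def algebra_simps)
  have "real n * (\<Sum>i<q. hi i - lo i)\<^sup>2 < (norm y)\<^sup>2"
  \<comment> \<open>Strictness has two sources: the summand 1 in \<open>D\<close> leaves a spare
    \<open>(norm z)\<^sup>2\<close> if \<open>z\<close> is nonzero, and otherwise
    \<open>y \<noteq> 0\<close> gives it.\<close>
  proof (cases "z = 0")
    case True
    then show ?thesis using sum_sq assms(5) by simp
  next
    case False
    then have "0 < (norm z)\<^sup>2"
      by simp
    then show ?thesis
      using z_le mult_left_mono[OF sum_sq, of "real n"] by linarith
  qed
  then have "sqrt (real n) * (\<Sum>i<q. hi i - lo i) < norm y"
    by - (rule power2_less_imp_less, simp_all add: power_mult_distrib)
  also have "norm y \<le> sqrt (real n) * (M - m)"
    using norm_le_range_if_orthogonal_ones[OF assms(6)] by (simp add: card M_def m_def)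
  finally have "(\<Sum>i<q. hi i - lo i) < M - m"
    using \<open>n > 0\<close> by simp
  then obtain t where t: "m < t" "t < M" "\<And>i. i < q \<Longrightarrow> t \<notin> {lo i<..hi i}"
    using exists_uncovered_point[of "{..<q}" lo hi M m] lo_le_hi by auto
  \<comment> \<open>Either \<open>t \<le> lo i\<close> and no entry of the block is below
    \<open>t\<close>, or \<open>hi i < t\<close> and all are.\<close>
  have "y $ v j < t \<longleftrightarrow> y $ v k < t" if "i < q" "j \<in> B i" "k \<in> B i" for i j k
    using t(3)[OF that(1)] lo_hi[OF that(2)] lo_hi[OF that(3)] by auto
  then show ?thesis
    using t(1,2) unfolding recovers_cliques_def M_def m_def B_def by blast
qed

end
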